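(* For every $\varepsilon>0$ and every positive integer $t$, there is a finite graph $G$ with $\textit{VR}(G,t)<\varepsilon$.
   Context: The discrete Voronoi game on a finite graph $G$ with $t$ rounds: two players $\mathbf{A}$ and $\mathbf{B}$ alternately claim vertices of $G$, $\mathbf{A}$ first, each player claiming one vertex per round, for $t$ rounds (so $2t$ vertices are claimed; no vertex may be claimed twice; $G$ is assumed to have at least $2t$ vertices). Distances are shortest-path distances in $G$. At the end, each vertex strictly closer to the set of $\mathbf{A}$'s claimed vertices than to the set of $\mathbf{B}$'s claimed vertices belongs to $\mathbf{A}$, each vertex strictly closer to $\mathbf{B}$'s set belongs to $\mathbf{B}$, and each vertex at equal distance is tied (each player receives half of it). The Voronoi ratio $\textit{VR}(G,t)$ is the number of vertices belonging to $\mathbf{A}$ plus half the number of tied vertices, divided by $|V(G)|$, when both players play optimally ($\mathbf{A}$ maximizing this quantity and $\mathbf{B}$ minimizing it). *)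

theory Defs
  imports "Graph_Theory.Graph_Theory"
begin

text \<open>
  Every edge has weight 1, so this is the number of edges on a shortest path;
  it is \<open>\<infinity>\<close> for vertices in different components.
\<close>

definition graph_dist :: "'a pair_pre_digraph \<Rightarrow> 'a \<Rightarrow> 'a \<Rightarrow> ereal" where
  "graph_dist G u v = wf_digraph.\<mu> (with_proj G) (\<lambda>_. 1) u v"

definition set_dist :: "'a pair_pre_digraph \<Rightarrow> 'a \<Rightarrow> 'a set \<Rightarrow> ereal" where
  "set_dist G v S = (INF s\<in>S. graph_dist G v s)"

definition voronoi_score :: "'a pair_pre_digraph \<Rightarrow> 'a set \<Rightarrow> 'a set \<Rightarrow> real" where
  "voronoi_score G A B =
     real (card {v \<in> pverts G. set_dist G v A < set_dist G v B}) +
     real (card {v \<in> pverts G. set_dist G v A = set_dist G v B}) / 2"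

text \<open>
  The minimax value of the position with \<open>k\<close> rounds left in which the players have
  claimed \<open>A\<close> and \<open>B\<close>. It is meaningful only if at least \<open>2 * k\<close> vertices are unclaimed;
  otherwise \<open>Max\<close> or \<open>Min\<close> is applied to the empty set.
\<close>

primrec voronoi_value :: "'a pair_pre_digraph \<Rightarrow> nat \<Rightarrow> 'a set \<Rightarrow> 'a set \<Rightarrow> real" where
  "voronoi_value G 0 A B = voronoi_score G A B"
| "voronoi_value G (Suc k) A B =
     (MAX a \<in> pverts G - (A \<union> B).
       MIN b \<in> pverts G - (insert a A \<union> B).
         voronoi_value G k (insert a A) (insert b B))"

definition voronoi_ratio :: "'a pair_pre_digraph \<Rightarrow> nat \<Rightarrow> real" where
  "voronoi_ratio G t = voronoi_value G t {} {} / real (card (pverts G))"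

end

theory Submission
  imports Defs "HOL-Library.Countable"
begin

text \<open>
  Suppose for every vertex \<open>a\<close> there is a vertex \<open>reply a\<close> such that all but \<open>\<beta>\<close> vertices are
  strictly closer to \<open>reply a\<close> than to \<open>a\<close>. The second player answers \<open>a\<close> by \<open>reply a\<close>, or arbitrarily if
  \<open>reply a\<close> is already claimed. Outside the at most \<open>t * \<beta>\<close> exceptional vertices, the reply to
  the nearest vertex of the first player is strictly nearer, hence claimed by the second player.

  Graphs with good replies come from a Condorcet cycle: there are \<open>k\<close> candidates and \<open>k\<close> large
  groups of voters, and group \<open>j\<close> ranks the candidates by distance in the cyclic order
  \<open>j, j + 1, \<dots>, j - 1\<close>. Then candidate \<open>i - 1\<close> beats candidate \<open>i\<close> in every group but group \<open>i\<close>.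
  The connections are long, so that a vertex that is not a candidate is useful only to the group
  in whose part of the graph it lies, and otherwise is no better than the candidate next to it.
\<close>

section \<open>Distances\<close>

lemma graph_dist_le_relpow:
  assumes "pair_wf_digraph G" "u \<in> pverts G" "(u, v) \<in> parcs G ^^ n"
  shows "graph_dist G u v \<le> ereal (real n)"
proof -
  interpret pair_wf_digraph G by fact
  have "\<exists>p. awalk u p v \<and> awalk_cost (\<lambda>_. 1) p = real n"
    using assms(2,3)
  proof (induction n arbitrary: u)
    case 0
    then show ?case by (intro exI[of _ "[]"]) (auto simp: awalk_Nil_iff)
  next
    case (Suc n)
    from Suc.prems(2) obtain w where w: "(u, w) \<in> parcs G" "(w, v) \<in> parcs G ^^ n"
      by (meson relpow_Suc_D2)
    then have "w \<in> pverts G" using arc_snd_in_verts by fastforce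
    then obtain p where "awalk w p v" "awalk_cost (\<lambda>_. 1) p = real n"
      using Suc.IH w by blast
    then show ?case
      using w by (intro exI[of _ "(u, w) # p"]) (auto simp: awalk_Cons_iff)
  qed
  then show ?thesis
    unfolding graph_dist_def by (metis min_cost_le_walk_cost)
qed

text \<open>Each arc lowers \<open>f\<close> by at most 1, so a walk ending at a zero of
  \<open>f\<close> has at least \<open>f u\<close> arcs; without any walk the distance is
  infinite.\<close>

lemma graph_dist_ge_Lipschitz:
  fixes f :: "'a \<Rightarrow> nat"
  assumes "pair_wf_digraph G" "\<And>x y. (x, y) \<in> parcs G \<Longrightarrow> f x \<le> f y + 1" "f v = 0"
  shows "ereal (real (f u)) \<le> graph_dist G u v"
proof -
  interpret pair_wf_digraph G by fact
  have "real (f u) \<le> awalk_cost (\<lambda>_. 1) p" if "awalk u p v" for p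
    using that
  proof (induction p arbitrary: u)
    case Nil
    then show ?case using assms(3) by (auto simp: awalk_Nil_iff)
  next
    case (Cons e p)
    obtain x y where "e = (x, y)" by fastforce
    then show ?case using Cons assms(2)[of x y] by (fastforce simp: awalk_Cons_iff)
  qed
  then show ?thesis
    unfolding graph_dist_def \<mu>_def by (auto intro: INF_greatest)
qed

section \<open>The strategy of the second player\<close>

text \<open>Ties count as failures of \<open>b\<close>, because they still pay half to the first
  player.\<close>

definition not_closer :: "'a pair_pre_digraph \<Rightarrow> 'a \<Rightarrow> 'a \<Rightarrow> 'a set" where
  "not_closer G b a = {v \<in> pverts G. \<not> graph_dist G v b < graph_dist G v a}"

lemma voronoi_score_le_reply:
  assumes fin: "finite (pverts G)" and A: "finite A" "A \<noteq> {}"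
    and reply: "\<And>a. a \<in> A \<Longrightarrow> reply a \<in> A \<union> B"
    and bad: "\<And>a. a \<in> A \<Longrightarrow> card (not_closer G (reply a) a) \<le> \<beta>"
  shows "voronoi_score G A B \<le> real (card A * \<beta>)"
proof -
  let ?L = "{v \<in> pverts G. set_dist G v A < set_dist G v B}"
  let ?E = "{v \<in> pverts G. set_dist G v A = set_dist G v B}"
  let ?N = "\<Union>a\<in>A. not_closer G (reply a) a"
  have finN: "finite ?N" using fin A by (auto simp: not_closer_def)
  have closer: "set_dist G v B < set_dist G v A" if "v \<in> pverts G" "v \<notin> ?N" for v
  proof -
    have "set_dist G v A \<in> graph_dist G v ` A"
      unfolding set_dist_def using A by (metis Min_Inf Min_in finite_imageI image_is_empty)
    then obtain a where a: "a \<in> A" "set_dist G v A = graph_dist G v a" by blast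
    have less: "graph_dist G v (reply a) < graph_dist G v a"
      using that a by (auto simp: not_closer_def)
    \<comment> \<open>\<open>a\<close> is nearest to \<open>v\<close> within \<open>A\<close>, and
      the reply is nearer still.\<close>
    have "reply a \<notin> A"
      using less a unfolding set_dist_def by (metis INF_lower leD)
    then have "reply a \<in> B" using reply a by blast
    then have "set_dist G v B \<le> graph_dist G v (reply a)"
      unfolding set_dist_def by (rule INF_lower)
    then show ?thesis using less a by simp
  qed
  have sub: "?L \<union> ?E \<subseteq> ?N"
  proof
    fix v assume "v \<in> ?L \<union> ?E"
    then have "v \<in> pverts G" "\<not> set_dist G v B < set_dist G v A" by auto
    then show "v \<in> ?N" using closer by blast
  qed
  have "card ?L + card ?E = card (?L \<union> ?E)"
    using fin by (intro card_Un_disjoint[symmetric]) auto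
  also have "\<dots> \<le> card ?N" using finN sub by (rule card_mono)
  also have "\<dots> \<le> (\<Sum>a\<in>A. card (not_closer G (reply a) a))"
    using A by (intro card_UN_le)
  also have "\<dots> \<le> card A * \<beta>"
    using sum_bounded_above[OF bad] by simp
  finally have "card ?L + card ?E \<le> card A * \<beta>" .
  then have "real (card ?L + card ?E) \<le> real (card A * \<beta>)"
    by (simp only: of_nat_le_iff)
  then show ?thesis unfolding voronoi_score_def of_nat_add by linarith
qed

text \<open>The bound on \<open>card A + card B + 2 * k\<close> keeps each \<open>Max\<close> and
  \<open>Min\<close> over a nonempty set, and \<open>card A + k > 0\<close> makes the final
  \<open>A\<close> nonempty, as the score bound requires.\<close>

lemma voronoi_value_le_reply:
  assumes fin: "finite (pverts G)"
    and reply: "\<And>a. a \<in> pverts G \<Longrightarrow> reply a \<in> pverts G"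
    and bad: "\<And>a. a \<in> pverts G \<Longrightarrow> card (not_closer G (reply a) a) \<le> \<beta>"
    and "A \<subseteq> pverts G" "B \<subseteq> pverts G" "\<And>a. a \<in> A \<Longrightarrow> reply a \<in> A \<union> B"
    and "card A + card B + 2 * k \<le> card (pverts G)" "card A + k > 0"
  shows "voronoi_value G k A B \<le> real ((card A + k) * \<beta>)"
  using assms(4-8)
proof (induction k arbitrary: A B)
  case 0
  have "voronoi_score G A B \<le> real (card A * \<beta>)"
    using 0 fin bad by (intro voronoi_score_le_reply[where reply = reply])
      (auto dest: finite_subset)
  then show ?case by simp
next
  case (Suc k)
  have finA: "finite A" and finB: "finite B"
    using fin Suc.prems finite_subset by blast+
  have room: "pverts G - C \<noteq> {}" if "finite C" "card C < card (pverts G)" for C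
    using that by (metis Diff_eq_empty_iff card_mono leD)
  have cardAB: "card (A \<union> B) \<le> card A + card B" by (rule card_Un_le)
  have move: "(MIN b \<in> pverts G - (insert a A \<union> B). voronoi_value G k (insert a A) (insert b B))
      \<le> real ((card A + Suc k) * \<beta>)" if a: "a \<in> pverts G - (A \<union> B)" for a
  proof -
    have cardA: "card (insert a A) = Suc (card A)" using a finA by simp
    have "card (insert a A \<union> B) \<le> card (insert a A) + card B" by (rule card_Un_le)
    then have "pverts G - (insert a A \<union> B) \<noteq> {}"
      using Suc.prems(4) cardA finA finB by (intro room) auto
    then obtain c where c: "c \<in> pverts G - (insert a A \<union> B)" by blast
    \<comment> \<open>If the reply is already taken, the invariant holds for \<open>a\<close> and
      any free vertex will do.\<close>
    define b where "b = (if reply a \<in> insert a A \<union> B then c else reply a)"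
    have b: "b \<in> pverts G - (insert a A \<union> B)" using c reply a by (auto simp: b_def)
    have "voronoi_value G k (insert a A) (insert b B) \<le> real ((card (insert a A) + k) * \<beta>)"
    proof (rule Suc.IH)
      show "reply x \<in> insert a A \<union> insert b B" if "x \<in> insert a A" for x
        using that Suc.prems(3)[of x] by (auto simp: b_def)
      have "card (insert b B) = Suc (card B)" using b finB by simp
      then show "card (insert a A) + card (insert b B) + 2 * k \<le> card (pverts G)"
        using Suc.prems cardA by simp
    qed (use Suc.prems a b cardA in auto)
    also have "\<dots> = real ((card A + Suc k) * \<beta>)" using cardA by simp
    finally show ?thesis
      using b fin by (intro order_trans[OF Min_le]) auto
  qed
  have "pverts G - (A \<union> B) \<noteq> {}"
    using Suc.prems(4) cardAB finA finB by (intro room) auto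
  then show ?case
    using move fin by (auto simp del: of_nat_mult)
qed

section \<open>The Condorcet graph\<close>

text \<open>
  \<open>Tooth j i s\<close> is the vertex at distance \<open>s\<close> from \<open>Cand i\<close> on the connection from candidate \<open>i\<close>
  to group \<open>j\<close>. The far ends \<open>Tooth j i k\<close> form a path, in the order in which group \<open>j\<close> ranks the
  candidates, and the voters \<open>Voter j l\<close> are attached to its first vertex \<open>Tooth j j k\<close>.
\<close>

datatype comb_vertex = Cand nat | Tooth nat nat nat | Voter nat nat

instance comb_vertex :: countable
  by countable_datatype

definition cyc_next :: "nat \<Rightarrow> nat \<Rightarrow> nat" where
  "cyc_next k i = (if Suc i = k then 0 else Suc i)"

definition cyc_prev :: "nat \<Rightarrow> nat \<Rightarrow> nat" where
  "cyc_prev k i = (if i = 0 then k - 1 else i - 1)"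

text \<open>For \<open>i, j < k\<close> this is \<open>i - j\<close> modulo \<open>k\<close>, so the
  favourite of group \<open>j\<close> has rank 0.\<close>

definition rank :: "nat \<Rightarrow> nat \<Rightarrow> nat \<Rightarrow> nat" where
  "rank k j i = (if j \<le> i then i - j else i + k - j)"

text \<open>The condition \<open>cyc_next k i \<noteq> j\<close> omits the edge from the last-ranked
  far end back to the first, which would close the path to a cycle.\<close>

inductive comb_edge :: "nat \<Rightarrow> nat \<Rightarrow> comb_vertex \<Rightarrow> comb_vertex \<Rightarrow> bool" for k M where
  "j < k \<Longrightarrow> i < k \<Longrightarrow> comb_edge k M (Cand i) (Tooth j i 1)"
| "j < k \<Longrightarrow> i < k \<Longrightarrow> 1 \<le> s \<Longrightarrow> s < k \<Longrightarrow> comb_edge k M (Tooth j i s) (Tooth j i (Suc s))"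
| "j < k \<Longrightarrow> i < k \<Longrightarrow> cyc_next k i \<noteq> j \<Longrightarrow>
     comb_edge k M (Tooth j i k) (Tooth j (cyc_next k i) k)"
| "j < k \<Longrightarrow> l < M \<Longrightarrow> comb_edge k M (Tooth j j k) (Voter j l)"

definition comb_core :: "nat \<Rightarrow> comb_vertex set" where
  "comb_core k = Cand ` {..<k} \<union> (\<lambda>(j, i, s). Tooth j i s) ` ({..<k} \<times> {..<k} \<times> {1..k})"

definition comb_verts :: "nat \<Rightarrow> nat \<Rightarrow> comb_vertex set" where
  "comb_verts k M = comb_core k \<union> (\<lambda>(j, l). Voter j l) ` ({..<k} \<times> {..<M})"

definition comb_arcs :: "nat \<Rightarrow> nat \<Rightarrow> (comb_vertex \<times> comb_vertex) set" where
  "comb_arcs k M = {(x, y). comb_edge k M x y \<or> comb_edge k M y x}"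

text \<open>Vertices are coded by \<open>to_nat\<close> because the final graph has vertices of type
  \<open>nat\<close>.\<close>

definition comb_graph :: "nat \<Rightarrow> nat \<Rightarrow> nat pair_pre_digraph" where
  "comb_graph k M = \<lparr> pverts = to_nat ` comb_verts k M,
     parcs = map_prod to_nat to_nat ` comb_arcs k M \<rparr>"

lemma cyc_next_less: "i < k \<Longrightarrow> cyc_next k i < k"
  by (auto simp: cyc_next_def)

lemma comb_verts_simps [simp]:
  "Cand i \<in> comb_verts k M \<longleftrightarrow> i < k"
  "Tooth j i s \<in> comb_verts k M \<longleftrightarrow> j < k \<and> i < k \<and> 1 \<le> s \<and> s \<le> k"
  "Voter j l \<in> comb_verts k M \<longleftrightarrow> j < k \<and> l < M"
  by (force simp: comb_verts_def comb_core_def)+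

lemma finite_comb_core: "finite (comb_core k)"
  by (auto simp: comb_core_def)

lemma card_comb_core: "card (comb_core k) = k + k ^ 3"
proof -
  have "card (comb_core k) = card (Cand ` {..<k})
      + card ((\<lambda>(j, i, s). Tooth j i s) ` ({..<k} \<times> {..<k} \<times> {1..k}))"
    unfolding comb_core_def by (rule card_Un_disjoint) auto
  also have "card (Cand ` {..<k}) = k" by (subst card_image) (auto simp: inj_on_def)
  also have "card ((\<lambda>(j, i, s). Tooth j i s) ` ({..<k} \<times> {..<k} \<times> {1..k})) = k ^ 3"
    by (subst card_image) (auto simp: inj_on_def power3_eq_cube)
  finally show ?thesis .
qed

lemma finite_comb_verts: "finite (comb_verts k M)"
  by (simp add: comb_verts_def finite_comb_core)

lemma card_comb_verts: "card (comb_verts k M) = k + k ^ 3 + k * M"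
proof -
  have "card (comb_verts k M)
      = card (comb_core k) + card ((\<lambda>(j, l). Voter j l) ` ({..<k} \<times> {..<M}))"
    unfolding comb_verts_def by (rule card_Un_disjoint) (auto simp: comb_core_def)
  also have "card ((\<lambda>(j, l). Voter j l) ` ({..<k} \<times> {..<M})) = k * M"
    by (subst card_image) (auto simp: inj_on_def)
  finally show ?thesis by (simp add: card_comb_core)
qed

lemma comb_edge_verts:
  assumes "comb_edge k M x y"
  shows "x \<in> comb_verts k M" "y \<in> comb_verts k M"
  using assms by (auto elim!: comb_edge.cases simp: cyc_next_less)

lemma comb_edge_irrefl: "2 \<le> k \<Longrightarrow> \<not> comb_edge k M x x"
  by (auto elim!: comb_edge.cases simp: cyc_next_def split: if_splits)

lemma pair_graph_comb_graph:
  assumes "2 \<le> k"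
  shows "pair_graph (comb_graph k M)"
proof unfold_locales
  have arcs: "comb_arcs k M \<subseteq> comb_verts k M \<times> comb_verts k M"
    by (auto simp: comb_arcs_def comb_edge_verts)
  show "fst e \<in> pverts (comb_graph k M)" "snd e \<in> pverts (comb_graph k M)"
    if "e \<in> parcs (comb_graph k M)" for e
    using that arcs by (auto simp: comb_graph_def)
  show "finite (pverts (comb_graph k M))"
    by (simp add: comb_graph_def finite_comb_verts)
  show "finite (parcs (comb_graph k M))"
    using finite_subset[OF arcs] by (simp add: comb_graph_def finite_comb_verts)
  show "fst e \<noteq> snd e" if "e \<in> parcs (comb_graph k M)" for e
    using that comb_edge_irrefl[OF assms] by (auto simp: comb_graph_def comb_arcs_def)
  show "symmetric (comb_graph k M)"
    unfolding symmetric_def sym_def by (force simp: comb_graph_def comb_arcs_def)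
qed

lemma pair_wf_digraph_comb_graph: "2 \<le> k \<Longrightarrow> pair_wf_digraph (comb_graph k M)"
  using pair_graph_comb_graph
  by (simp add: pair_graph_def pair_digraph_def pair_fin_digraph_def)

section \<open>Upper and lower distance bounds in the Condorcet graph\<close>

lemma relpow_map_prod:
  "(x, y) \<in> E ^^ n \<Longrightarrow> (f x, f y) \<in> (map_prod f f ` E) ^^ n"
proof (induction n arbitrary: y)
  case (Suc n)
  then obtain z where "(x, z) \<in> E ^^ n" "(z, y) \<in> E" by auto
  then show ?case using Suc.IH by (auto intro!: relcompI)
qed simp

lemma relpow_Tooth_Cand:
  assumes "j < k" "i < k"
  shows "Suc s \<le> k \<Longrightarrow> (Tooth j i (Suc s), Cand i) \<in> comb_arcs k M ^^ Suc s"
proof (induction s)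
  case 0
  then show ?case using assms comb_edge.intros(1)[of j k i M] by (simp add: comb_arcs_def)
next
  case (Suc s)
  have "(Tooth j i (Suc (Suc s)), Tooth j i (Suc s)) \<in> comb_arcs k M"
    using assms Suc comb_edge.intros(2)[of j k i "Suc s" M] by (simp add: comb_arcs_def)
  then show ?case using Suc by (meson Suc_leD relpow_Suc_I2)
qed

lemma relpow_spine:
  assumes "j < k"
  shows "i < k \<Longrightarrow> (Tooth j j k, Tooth j i k) \<in> comb_arcs k M ^^ rank k j i"
proof (induction "rank k j i" arbitrary: i)
  case 0
  then have "i = j" using assms by (auto simp: rank_def split: if_splits)
  then show ?case by (simp add: rank_def)
next
  case (Suc n)
  \<comment> \<open>Since \<open>i \<noteq> j\<close>, the cyclic predecessor is one step closer to
    the start of the path.\<close>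
  define i' where "i' = cyc_prev k i"
  have i': "i' < k" "cyc_next k i' = i" "i \<noteq> j" "n = rank k j i'"
    using Suc assms by (auto simp: i'_def cyc_prev_def cyc_next_def rank_def split: if_splits)
  have "(Tooth j i' k, Tooth j i k) \<in> comb_arcs k M"
    using comb_edge.intros(3)[of j k i' M] i' assms by (simp add: comb_arcs_def)
  then have "(Tooth j j k, Tooth j i k) \<in> comb_arcs k M ^^ Suc n"
    using Suc.hyps(1)[of i'] i' by auto
  then show ?case using Suc.hyps(2) by simp
qed

text \<open>One edge onto the path, \<open>rank k j i\<close> edges along it, then \<open>k\<close>
  edges down to the candidate.\<close>

lemma relpow_Voter_Cand:
  assumes "j < k" "i < k" "l < M"
  shows "(Voter j l, Cand i) \<in> comb_arcs k M ^^ (1 + rank k j i + k)"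
proof -
  have "(Voter j l, Tooth j j k) \<in> comb_arcs k M ^^ 1"
    using comb_edge.intros(4)[of j k l M] assms by (simp add: comb_arcs_def)
  moreover have "(Tooth j i k, Cand i) \<in> comb_arcs k M ^^ k"
    using relpow_Tooth_Cand[of j k i "k - 1" M] assms by simp
  ultimately show ?thesis
    using relpow_spine[OF assms(1,2), of M] by (meson relpow_trans)
qed

text \<open>
  A 1-Lipschitz function with zeros at candidate \<open>i\<close>, at the voters of group \<open>j\<close>, on the connection
  between them and at the far ends of the other connections of group \<open>j\<close>. At the voters of the
  other groups it is as large as their distance to candidate \<open>i\<close>.
\<close>

fun comb_height :: "nat \<Rightarrow> nat \<Rightarrow> nat \<Rightarrow> comb_vertex \<Rightarrow> nat" where
  "comb_height k j i (Cand i') = (if i' = i then 0 else k)"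
| "comb_height k j i (Tooth j' i' s) =
     (if j' = j then if i' = i then 0 else k - s
      else if i' = i then s else k + min s (rank k j' i - rank k j' i'))"
| "comb_height k j i (Voter j' l) = (if j' = j then 0 else k + rank k j' i + 1)"

lemma comb_height_edge:
  assumes "comb_edge k M x y" "i < k"
  shows "comb_height k j i x \<le> comb_height k j i y + 1 \<and>
    comb_height k j i y \<le> comb_height k j i x + 1"
  using assms
proof cases
  case (3 j' i')
  then have "rank k j' (cyc_next k i') = Suc (rank k j' i')"
    by (auto simp: rank_def cyc_next_def split: if_splits)
  with 3 show ?thesis by auto
next
  case (4 j' l)
  \<comment> \<open>Ranks are below \<open>k\<close>, so the cap in \<open>min\<close> is inactive
    at the far end.\<close>
  then show ?thesis using assms(2) by (auto simp: rank_def)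
qed auto

lemma comb_arcs_height:
  "(x, y) \<in> comb_arcs k M \<Longrightarrow> i < k \<Longrightarrow> comb_height k j i x \<le> comb_height k j i y + 1"
  using comb_height_edge by (auto simp: comb_arcs_def)

lemma graph_dist_comb_le:
  assumes "2 \<le> k" "j < k" "i < k" "l < M"
  shows "graph_dist (comb_graph k M) (to_nat (Voter j l)) (to_nat (Cand i))
    \<le> ereal (real (1 + rank k j i + k))"
proof (rule graph_dist_le_relpow)
  show "pair_wf_digraph (comb_graph k M)"
    using assms(1) by (rule pair_wf_digraph_comb_graph)
  show "to_nat (Voter j l) \<in> pverts (comb_graph k M)"
    using assms by (simp add: comb_graph_def)
  show "(to_nat (Voter j l), to_nat (Cand i)) \<in> parcs (comb_graph k M) ^^ (1 + rank k j i + k)"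
    using relpow_map_prod[OF relpow_Voter_Cand] assms by (simp add: comb_graph_def)
qed

lemma graph_dist_comb_ge:
  assumes "2 \<le> k" "i < k" "comb_height k j i a = 0"
  shows "ereal (real (comb_height k j i v)) \<le> graph_dist (comb_graph k M) (to_nat v) (to_nat a)"
proof -
  let ?f = "\<lambda>n. comb_height k j i (from_nat n)"
  have "ereal (real (?f (to_nat v))) \<le> graph_dist (comb_graph k M) (to_nat v) (to_nat a)"
  proof (rule graph_dist_ge_Lipschitz)
    show "pair_wf_digraph (comb_graph k M)"
      using assms(1) by (rule pair_wf_digraph_comb_graph)
    show "?f x \<le> ?f y + 1" if "(x, y) \<in> parcs (comb_graph k M)" for x y
      using that comb_arcs_height[OF _ assms(2)] by (auto simp: comb_graph_def)
  qed (use assms in simp)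
  then show ?thesis by simp
qed

lemma comb_height_zero_ex:
  assumes "a \<in> comb_verts k M"
  shows "\<exists>j<k. \<exists>i<k. comb_height k j i a = 0"
  using assms by (cases a) auto

lemma comb_graph_reply:
  assumes "2 \<le> k" "a \<in> pverts (comb_graph k M)"
  shows "\<exists>b\<in>pverts (comb_graph k M). card (not_closer (comb_graph k M) b a) \<le> k + k ^ 3 + 2 * M"
proof -
  obtain x where x: "x \<in> comb_verts k M" "a = to_nat x"
    using assms by (auto simp: comb_graph_def)
  \<comment> \<open>For voters outside group \<open>j\<close>, \<open>x\<close> is no closer than
    candidate \<open>i\<close>.\<close>
  obtain j i where ji: "j < k" "i < k" "comb_height k j i x = 0"
    using comb_height_zero_ex x by blast
  define b where "b = Cand (cyc_prev k i)"
  have prev: "cyc_prev k i < k" using ji by (auto simp: cyc_prev_def)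
  \<comment> \<open>Given up are the core, group \<open>i\<close>, which ranks candidate
    \<open>i\<close> first, and group \<open>j\<close>, to which \<open>x\<close> may be
    close.\<close>
  let ?W = "comb_core k \<union> (\<lambda>(j, l). Voter j l) ` ({i, j} \<times> {..<M})"
  have "not_closer (comb_graph k M) (to_nat b) a \<subseteq> to_nat ` ?W"
  proof
    fix n assume n: "n \<in> not_closer (comb_graph k M) (to_nat b) a"
    then obtain v where v: "n = to_nat v" "v \<in> comb_verts k M"
      by (auto simp: not_closer_def comb_graph_def)
    have "v \<in> ?W"
    proof (rule ccontr)
      assume "v \<notin> ?W"
      then obtain j' l where vt: "v = Voter j' l" "j' < k" "l < M" "j' \<noteq> i" "j' \<noteq> j"
        using v(2) by (auto simp: comb_verts_def)
      \<comment> \<open>As \<open>j' \<noteq> i\<close>, group \<open>j'\<close> does not rank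
        candidate \<open>i\<close> first, so the predecessor is one edge closer.\<close>
      have "rank k j' i = Suc (rank k j' (cyc_prev k i))"
        using vt ji by (auto simp: rank_def cyc_prev_def)
      then have "1 + rank k j' (cyc_prev k i) + k < comb_height k j i v"
        using vt by simp
      then have "ereal (real (1 + rank k j' (cyc_prev k i) + k)) < ereal (real (comb_height k j i v))"
        by (simp only: ereal_less_eq less_ereal.simps of_nat_less_iff)
      then have "graph_dist (comb_graph k M) n (to_nat b) < graph_dist (comb_graph k M) n a"
        using graph_dist_comb_le[OF assms(1) vt(2) prev vt(3)]
          graph_dist_comb_ge[OF assms(1) ji(2,3), where v = v and M = M]
        unfolding v x b_def vt(1) by (meson le_less_trans less_le_trans)
      then show False using n by (simp add: not_closer_def)
    qed
    then show "n \<in> to_nat ` ?W" using v by blast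
  qed
  then have "card (not_closer (comb_graph k M) (to_nat b) a) \<le> card (to_nat ` ?W)"
    by (rule card_mono[rotated]) (simp add: finite_comb_core)
  also have "\<dots> \<le> card ?W" by (rule card_image_le) (simp add: finite_comb_core)
  also have "\<dots> \<le> card (comb_core k) + card ((\<lambda>(j, l). Voter j l) ` ({i, j} \<times> {..<M}))"
    by (rule card_Un_le)
  also have "card ((\<lambda>(j, l). Voter j l) ` ({i, j} \<times> {..<M})) \<le> card ({i, j} \<times> {..<M})"
    by (rule card_image_le) simp
  also have "\<dots> \<le> 2 * M" by (simp add: card_insert_if)
  finally have "card (not_closer (comb_graph k M) (to_nat b) a) \<le> k + k ^ 3 + 2 * M"
    by (simp add: card_comb_core)
  moreover have "to_nat b \<in> pverts (comb_graph k M)"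
    using prev by (simp add: b_def comb_graph_def)
  ultimately show ?thesis by blast
qed

theorem theorem1:
  fixes \<epsilon> :: real and t :: nat
  assumes "\<epsilon> > 0" and "t \<ge> 1"
  shows "\<exists>G :: nat pair_pre_digraph.
           pair_graph G \<and> card (pverts G) \<ge> 2 * t \<and> voronoi_ratio G t < \<epsilon>"
proof -
  obtain k0 :: nat where k0: "3 * real t / \<epsilon> < real k0" using reals_Archimedean2 by blast
  \<comment> \<open>\<open>k0\<close> makes the final ratio small; \<open>2 * t\<close> ensures
    enough vertices and \<open>2 \<le> k\<close>.\<close>
  define k where "k = k0 + 2 * t"
  \<comment> \<open>With \<open>M\<close> the size of the core, each reply loses at most
    \<open>3 * M\<close> of the \<open>(k + 1) * M\<close> vertices.\<close>
  define M where "M = k + k ^ 3"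
  define G where "G = comb_graph k M"
  have k: "2 \<le> k" "2 * t \<le> k" using assms by (auto simp: k_def)
  have pos: "0 < M" using k by (simp add: M_def)
  have graph: "pair_graph G" unfolding G_def using k by (intro pair_graph_comb_graph)
  have card: "card (pverts G) = (k + 1) * M"
    by (simp add: G_def comb_graph_def card_image card_comb_verts M_def algebra_simps)
  have "k \<le> (k + 1) * M" using pos by (cases M) auto
  then have size: "2 * t \<le> card (pverts G)" using k card by simp
  have "\<forall>a\<in>pverts G. \<exists>b\<in>pverts G. card (not_closer G b a) \<le> 3 * M"
    using comb_graph_reply[OF k(1), of _ M] by (simp add: G_def M_def)
  then obtain reply where reply: "\<And>a. a \<in> pverts G \<Longrightarrow> reply a \<in> pverts G"
      "\<And>a. a \<in> pverts G \<Longrightarrow> card (not_closer G (reply a) a) \<le> 3 * M"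
    by metis
  have "voronoi_value G t {} {} \<le> real ((card ({} :: nat set) + t) * (3 * M))"
  proof (rule voronoi_value_le_reply[where reply = reply])
    show "finite (pverts G)" by (simp add: G_def comb_graph_def finite_comb_verts)
  qed (use reply size assms in auto)
  then have "voronoi_ratio G t \<le> real (t * (3 * M)) / real ((k + 1) * M)"
    unfolding voronoi_ratio_def card by (intro divide_right_mono) auto
  also have "\<dots> = 3 * real t / real (k + 1)" using pos by (simp only: of_nat_mult) simp
  also have "\<dots> < \<epsilon>"
  proof -
    have "3 * real t / \<epsilon> < real (k + 1)" using k0 by (simp add: k_def)
    then show ?thesis using assms by (simp add: field_simps)
  qed
  finally show ?thesis using graph size by blast
qed

end
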